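(* Let $n\ge 0$ be an integer and let $f:\mathbb{R}\rightarrow\mathbb{R}$ be a continuous $2\pi$-periodic function whose Fourier series is of the form $$f(x)\sim \sum_{k=n}^{\infty}[a_k\cos(kx)+b_k\sin(kx)],$$ with $a_n^2+b_n^2\neq 0$ (that is, all harmonic components of $f$ of order less than $n$ vanish, and the component of order $n$ does not vanish). Then $f$ has at least $2n$ distinct zeroes in the interval $[0,2\pi)$.
   Context: The real Fourier coefficients of a continuous $2\pi$-periodic function $f$ are $a_k=\frac{1}{\pi}\int_0^{2\pi}f(x)\cos(kx)\,dx$ and $b_k=\frac{1}{\pi}\int_0^{2\pi}f(x)\sin(kx)\,dx$ for $k\ge 1$, and the harmonic component of order $0$ is the mean value $a_0=\frac{1}{2\pi}\int_0^{2\pi}f(x)\,dx$ (with $b_0=0$). The symbol $\sim$ means that the right-hand side is the (formal) Fourier series of $f$; no convergence is assumed. That the series starts at $k=n$ means that $a_k=b_k=0$ for all $0\le k<n$. *)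

theory Defs
  imports "HOL-Analysis.Analysis"
begin

(* The coefficient of order 0 is the mean value itself (not twice it), so that it is the constant
   term of the series without a factor 1/2. *)
definition fourier_cos_coeff :: "(real \<Rightarrow> real) \<Rightarrow> nat \<Rightarrow> real" where
  "fourier_cos_coeff f k =
     (if k = 0 then (1 / (2 * pi)) * integral {0..2*pi} f
      else (1 / pi) * integral {0..2*pi} (\<lambda>x. f x * cos (real k * x)))"

definition fourier_sin_coeff :: "(real \<Rightarrow> real) \<Rightarrow> nat \<Rightarrow> real" where
  "fourier_sin_coeff f k =
     (if k = 0 then 0
      else (1 / pi) * integral {0..2*pi} (\<lambda>x. f x * sin (real k * x)))"

end

theory Submission
  imports Defs
begin

(* If f has fewer than 2n zeroes in [0, 2 pi), let T be the set of those at which f changes sign on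
   the circle (if an odd number of sign changes lie in (0, 2 pi), periodicity makes 0 the missing
   one).  Then |T| is even, the product of sin ((x - z) / 2) over z in T is a trigonometric
   polynomial of degree |T| / 2 < n and hence orthogonal to f, yet f times this product has constant
   sign.  So f times the product vanishes identically, which contradicts the finiteness of its
   zero set. *)

text \<open>The sign is weak so that the interval may begin or end at a zero. A zero between two
  points where \<open>f\<close> has strictly opposite signs is interior, as it differs from
  both.\<close>

lemma continuous_no_zero_const_sign:
  fixes f :: "real \<Rightarrow> real"
  assumes cont: "continuous_on {a..b} f"
    and nz: "\<And>x. a < x \<Longrightarrow> x < b \<Longrightarrow> f x \<noteq> 0"
  shows "\<exists>e\<in>{1,-1}. \<forall>x\<in>{a..b}. 0 \<le> e * f x"
proof (rule ccontr)
  assume "\<not> ?thesis"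
  then obtain x y where x: "x \<in> {a..b}" "f x < 0" and y: "y \<in> {a..b}" "f y > 0"
    by (auto simp: not_le)
  show False
  proof (cases "x \<le> y")
    case True
    have "continuous_on {x..y} f" using x y by (intro continuous_on_subset[OF cont]) auto
    then obtain w where "x \<le> w" "w \<le> y" "f w = 0" using IVT'[of f x 0 y] x y True by auto
    moreover from this have "x \<noteq> w" "y \<noteq> w" using x y by auto
    ultimately show False using nz[of w] x y by auto
  next
    case False
    have "continuous_on {y..x} f" using x y by (intro continuous_on_subset[OF cont]) auto
    then obtain w where "y \<le> w" "w \<le> x" "f w = 0" using IVT2'[of f x 0 y] x y False by auto
    moreover from this have "x \<noteq> w" "y \<noteq> w" using x y by auto
    ultimately show False using nz[of w] x y by auto
  qed
qed

text \<open>\<open>S\<close> collects the zeroes at which \<open>f\<close> changes sign. The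
  induction splits the interval at the largest zero \<open>c\<close>. As \<open>b\<close> is at most
  \<open>a + 2 * pi\<close>, all half-differences stay in [-pi, pi], so each factor has the sign of
  \<open>x - z\<close>, up to zeroes at the ends.\<close>

lemma exists_sin_prod_const_sign:
  fixes f :: "real \<Rightarrow> real"
  assumes "finite Z" "continuous_on {a..b} f" "{x \<in> {a<..<b}. f x = 0} = Z" "b \<le> a + 2 * pi"
  shows "\<exists>S e. S \<subseteq> Z \<and> e \<in> {1,-1} \<and>
    (\<forall>x\<in>{a..b}. 0 \<le> e * f x * (\<Prod>z\<in>S. sin ((x - z) / 2)))"
  using assms
proof (induction Z arbitrary: b rule: finite_linorder_max_induct)
  case empty
  then have "\<exists>e\<in>{1,-1}. \<forall>x\<in>{a..b}. 0 \<le> e * f x"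
    by (intro continuous_no_zero_const_sign) auto
  then show ?case by (intro exI[of _ "{}"]) auto
next
  case (insert c A)
  have c: "a < c" "c < b" "f c = 0" using insert.prems(2) by auto
  have Aless: "z < c" "a < z" if "z \<in> A" for z
    using insert.hyps insert.prems(2) that by auto
  have "{x \<in> {a<..<c}. f x = 0} = A"
    using insert.prems(2) insert.hyps(2) c by (auto simp: set_eq_iff)
  moreover have "continuous_on {a..c} f"
    using c by (intro continuous_on_subset[OF insert.prems(1)]) auto
  moreover have "c \<le> a + 2 * pi" using c insert.prems(3) by simp
  ultimately obtain S e where S: "S \<subseteq> A" "e \<in> {1,-1}"
    and left: "\<And>x. x \<in> {a..c} \<Longrightarrow> 0 \<le> e * f x * (\<Prod>z\<in>S. sin ((x - z) / 2))"
    using insert.IH[of c] by blast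
  have "\<exists>e\<in>{1,-1}. \<forall>x\<in>{c..b}. 0 \<le> e * f x"
  proof (rule continuous_no_zero_const_sign)
    show "continuous_on {c..b} f"
      using c by (intro continuous_on_subset[OF insert.prems(1)]) auto
    show "f x \<noteq> 0" if "c < x" "x < b" for x
    proof
      assume "f x = 0"
      then have "x \<in> {x \<in> {a<..<b}. f x = 0}" using that c by simp
      then have "x \<in> insert c A" unfolding insert.prems(2) .
      then show False using that insert.hyps(2) by auto
    qed
  qed
  then obtain e' where e': "e' \<in> {1,-1}" and right: "\<And>x. x \<in> {c..b} \<Longrightarrow> 0 \<le> e' * f x" by blast
  have pos: "0 \<le> (\<Prod>z\<in>S. sin ((x - z) / 2))" if "x \<in> {c..b}" for x
  proof (rule prod_nonneg)
    fix z assume "z \<in> S"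
    then have "z < c" "a < z" using Aless S by auto
    then show "0 \<le> sin ((x - z) / 2)" using that insert.prems(3) by (intro sin_ge_zero) auto
  qed
  show ?case
  proof (cases "e = e'")
    case True
    have "0 \<le> e * f x * (\<Prod>z\<in>S. sin ((x - z) / 2))" if "x \<in> {a..b}" for x
      using left[of x] right[of x] pos[of x] that True by (cases "x \<le> c") auto
    then show ?thesis using S by blast
  next
    \<comment> \<open>The signs to the left and right of \<open>c\<close> disagree, so
      \<open>c\<close> joins \<open>S\<close>: its factor is nonpositive on the left, which turns
      \<open>e\<close> into \<open>e'\<close>, and nonnegative on the right, which leaves
      \<open>e'\<close> alone.\<close>
    case False
    then have e'_eq: "e' = -e" using S e' by auto
    have fin: "finite S" using S insert.hyps(1) finite_subset by blast
    have "c \<notin> S" using S Aless by auto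
    have "0 \<le> e' * f x * (\<Prod>z\<in>insert c S. sin ((x - z) / 2))" if x: "x \<in> {a..b}" for x
    proof (cases "x \<le> c")
      case True
      have "0 \<le> sin ((c - x) / 2)" using True x c insert.prems(3) by (intro sin_ge_zero) auto
      then have s: "0 \<le> - sin ((x - c) / 2)" by (metis minus_diff_eq minus_divide_left sin_minus)
      have "0 \<le> (e * f x * (\<Prod>z\<in>S. sin ((x - z) / 2))) * (- sin ((x - c) / 2))"
        by (rule mult_nonneg_nonneg[OF left s]) (use x True in auto)
      also have "\<dots> = e' * f x * (\<Prod>z\<in>insert c S. sin ((x - z) / 2))"
        using fin \<open>c \<notin> S\<close> e'_eq by simp
      finally show ?thesis .
    next
      case False
      have s: "0 \<le> sin ((x - c) / 2)" using False x c insert.prems(3) by (intro sin_ge_zero) auto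
      have "0 \<le> (e' * f x) * (sin ((x - c) / 2) * (\<Prod>z\<in>S. sin ((x - z) / 2)))"
        by (rule mult_nonneg_nonneg[OF right mult_nonneg_nonneg[OF s pos]]) (use x False in auto)
      then show ?thesis using fin \<open>c \<notin> S\<close> by simp
    qed
    then show ?thesis using S e' by (intro exI[of _ "insert c S"] exI[of _ e']) auto
  qed
qed

(* The extra factor cos (s x + c), with s a half-integer when |T| is odd, lets the induction remove
   one sine at a time: each product-to-sum step shifts s by 1/2. *)
lemma integral_sin_prod_eq_0:
  fixes f :: "real \<Rightarrow> real"
  assumes cont: "continuous_on {0..2*pi} f"
    and coeff: "\<forall>k<n. fourier_cos_coeff f k = 0 \<and> fourier_sin_coeff f k = 0"
    and "finite T" "s + real (card T) / 2 \<in> \<int>" "\<bar>s\<bar> + real (card T) / 2 < real n"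
  shows "integral {0..2*pi} (\<lambda>x. f x * (\<Prod>z\<in>T. sin ((x - z) / 2)) * cos (s * x + c)) = 0"
  using assms(3-5)
proof (induction T arbitrary: s c rule: finite_induct)
  case empty
  \<comment> \<open>With no sines left, \<open>s\<close> itself is an integer, and its absolute
    value is a frequency below \<open>n\<close>.\<close>
  define k where "k = nat \<lfloor>\<bar>s\<bar>\<rfloor>"
  have k: "real k = \<bar>s\<bar>" using empty by (auto simp: k_def elim!: Ints_cases)
  then have "k < n" using empty by simp
  have cos0: "integral {0..2*pi} (\<lambda>x. f x * cos (real k * x)) = 0"
    using coeff \<open>k < n\<close> by (cases "k = 0") (auto simp: fourier_cos_coeff_def)
  have sin0: "integral {0..2*pi} (\<lambda>x. f x * sin (real k * x)) = 0"
    using coeff \<open>k < n\<close> by (cases "k = 0") (auto simp: fourier_sin_coeff_def)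
  \<comment> \<open>The addition formula yields sin (s x), which is sin (k x) or its negative
    according to the sign of \<open>s\<close>.\<close>
  define q where "q = (if s \<ge> 0 then - sin c else sin c)"
  have "f x * (\<Prod>z\<in>{}. sin ((x - z) / 2)) * cos (s * x + c)
      = cos c * (f x * cos (real k * x)) + q * (f x * sin (real k * x))" for x
    by (auto simp: k q_def cos_add algebra_simps abs_if)
  moreover have "integral {0..2*pi} (\<lambda>x. cos c * (f x * cos (real k * x)) +
      q * (f x * sin (real k * x))) = 0"
  proof (subst integral_add)
    show "(\<lambda>x. cos c * (f x * cos (real k * x))) integrable_on {0..2*pi}"
      "(\<lambda>x. q * (f x * sin (real k * x))) integrable_on {0..2*pi}"
      by (intro integrable_continuous_interval continuous_intros cont)+
  qed (simp only: Henstock_Kurzweil_Integration.integral_mult_right cos0 sin0 mult_zero_right add_0)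
  ultimately show ?case by simp
next
  case (insert z T)
  let ?P = "\<lambda>x. \<Prod>z\<in>T. sin ((x - z) / 2)"
  \<comment> \<open>Phases from sin A cos B = (sin (B + A) - sin (B - A)) / 2 with A = (x - z) / 2
    and B = s x + c; the shift by pi / 2 turns each sine back into a cosine.\<close>
  define u where "u = c - z / 2 - pi / 2"
  define v where "v = c + z / 2 - pi / 2"
  have eq: "f x * (\<Prod>z\<in>insert z T. sin ((x - z) / 2)) * cos (s * x + c)
      = (1/2) * (f x * ?P x * cos ((s + 1/2) * x + u))
        - (1/2) * (f x * ?P x * cos ((s - 1/2) * x + v))"
    for x
  proof -
    have 1: "cos ((s + 1/2) * x + u) = sin ((s * x + c) + (x - z) / 2)"
    proof -
      have "(s + 1/2) * x + u = - (pi / 2 - ((s * x + c) + (x - z) / 2))"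
        by (simp add: u_def algebra_simps add_divide_distrib diff_divide_distrib)
      then show ?thesis by (simp only: sin_cos_eq cos_minus of_real_eq_id id_apply)
    qed
    have 2: "cos ((s - 1/2) * x + v) = sin ((s * x + c) - (x - z) / 2)"
    proof -
      have "(s - 1/2) * x + v = - (pi / 2 - ((s * x + c) - (x - z) / 2))"
        by (simp add: v_def algebra_simps add_divide_distrib diff_divide_distrib)
      then show ?thesis by (simp only: sin_cos_eq cos_minus of_real_eq_id id_apply)
    qed
    show ?thesis
      unfolding 1 2 sin_add sin_diff using insert.hyps by (simp add: algebra_simps)
  qed
  have cardI: "real (card (insert z T)) = real (card T) + 1" using insert.hyps by simp
  \<comment> \<open>Removing \<open>z\<close> lowers half the cardinality by 1/2. This cancels the
    shift of \<open>s\<close> in the integrality condition and pays for the growth of its absolute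
    value in the bound.\<close>
  have "(s + 1/2) + real (card T) / 2 \<in> \<int>"
    using insert.prems(1) unfolding cardI by (simp add: field_simps)
  moreover have "\<bar>s + 1/2\<bar> + real (card T) / 2 < real n"
    using insert.prems(2) unfolding cardI by (simp add: field_simps abs_if split: if_splits)
  ultimately have I1: "integral {0..2*pi} (\<lambda>x. f x * ?P x * cos ((s + 1/2) * x + u)) = 0"
    by (rule insert.IH)
  \<comment> \<open>Here both changes are downward, so the sum drops by exactly 1 and remains an
    integer.\<close>
  have "s + real (card (insert z T)) / 2 - 1 \<in> \<int>" by (intro Ints_diff insert.prems(1)) auto
  then have "(s - 1/2) + real (card T) / 2 \<in> \<int>" unfolding cardI by (simp add: field_simps)
  moreover have "\<bar>s - 1/2\<bar> + real (card T) / 2 < real n"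
    using insert.prems(2) unfolding cardI by (simp add: field_simps abs_if split: if_splits)
  ultimately have I2: "integral {0..2*pi} (\<lambda>x. f x * ?P x * cos ((s - 1/2) * x + v)) = 0"
    by (rule insert.IH)
  show ?case unfolding eq
  proof (subst integral_diff)
    show "(\<lambda>x. (1/2) * (f x * ?P x * cos ((s + 1/2) * x + u))) integrable_on {0..2*pi}"
      "(\<lambda>x. (1/2) * (f x * ?P x * cos ((s - 1/2) * x + v))) integrable_on {0..2*pi}"
      by (intro integrable_continuous_interval continuous_intros cont; simp)+
  qed (simp only: Henstock_Kurzweil_Integration.integral_mult_right I1 I2 mult_zero_right diff_0_right)
qed

theorem theorem1:
  fixes n :: nat and f :: "real \<Rightarrow> real"
  assumes "continuous_on UNIV f"
    and "\<forall>x. f (x + 2 * pi) = f x"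
    and "\<forall>k<n. fourier_cos_coeff f k = 0 \<and> fourier_sin_coeff f k = 0"
    and "(fourier_cos_coeff f n)\<^sup>2 + (fourier_sin_coeff f n)\<^sup>2 \<noteq> 0"
  shows "\<exists>Z. Z \<subseteq> {x. 0 \<le> x \<and> x < 2 * pi \<and> f x = 0} \<and> finite Z \<and> card Z = 2 * n"
proof (rule ccontr)
  assume contra: "\<not> ?thesis"
  define Z where "Z = {x. 0 \<le> x \<and> x < 2 * pi \<and> f x = 0}"
  have none: "\<not> (X \<subseteq> Z \<and> finite X \<and> card X = 2 * n)" for X
    using contra unfolding Z_def by blast
  have fin: "finite Z"
    using infinite_arbitrarily_large[of Z "2 * n"] none by blast
  have card: "card Z < 2 * n"
    by (rule ccontr) (use none in \<open>auto simp: not_less elim: obtain_subset_with_card_n\<close>)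
  have cont: "continuous_on {0..2*pi} f" by (rule continuous_on_subset[OF assms(1)]) simp
  have inner: "{x \<in> {0<..<2*pi}. f x = 0} = Z - {0}" by (auto simp: Z_def)
  then obtain S e where S: "S \<subseteq> Z - {0}" and e: "e \<in> {1,-1}"
    and sgn: "\<forall>x\<in>{0..2*pi}. 0 \<le> e * f x * (\<Prod>z\<in>S. sin ((x - z) / 2))"
    using exists_sin_prod_const_sign[OF finite_Diff[OF fin] cont inner] by force
  have finS: "finite S" using S fin finite_subset by blast
  obtain T where T: "T \<subseteq> Z" "even (card T)"
    and sgnT: "\<forall>x\<in>{0..2*pi}. 0 \<le> e * f x * (\<Prod>z\<in>T. sin ((x - z) / 2))"
  proof (cases "even (card S)")
    case True
    then show ?thesis using that[of S] S sgn by auto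
  next
    case False
    \<comment> \<open>An odd number of half-angle sines makes \<open>P\<close> change sign under
      translation by 2 pi, whereas \<open>f\<close> does not. The sign conditions at the two ends
      then force \<open>f 0 * P 0\<close> to vanish.\<close>
    define P where "P = (\<lambda>x. \<Prod>z\<in>S. sin ((x - z) / 2))"
    have sgnP: "0 \<le> e * f x * P x" if "x \<in> {0..2*pi}" for x
      using bspec[OF sgn that] unfolding P_def .
    have "P (2 * pi) = (\<Prod>z\<in>S. - sin ((0 - z) / 2))"
      unfolding P_def by (intro prod.cong refl) (simp add: diff_divide_distrib)
    also have "\<dots> = - P 0" unfolding prod_uminus P_def using False by simp
    finally have "P (2 * pi) = - P 0" .
    moreover have "f (2 * pi) = f 0" using assms(2)[rule_format, of 0] by simp
    moreover have "0 \<le> e * f 0 * P 0" by (rule sgnP) simp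
    moreover have "0 \<le> e * f (2 * pi) * P (2 * pi)" by (rule sgnP) simp
    ultimately have "e * f 0 * P 0 = 0" by simp
    moreover have "P 0 \<noteq> 0"
    proof -
      have "sin ((0 - z) / 2) \<noteq> 0" if "z \<in> S" for z
        using sin_gt_zero[of "z / 2"] S that by (auto simp: Z_def subset_iff order_less_le)
      then show ?thesis using finS by (simp add: P_def)
    qed
    ultimately have "f 0 = 0" using e by auto
    then have "insert 0 S \<subseteq> Z" using S by (auto simp: Z_def)
    moreover have "0 \<notin> S" using S by auto
    moreover from this have "even (card (insert 0 S))" using False finS by simp
    moreover have "0 \<le> e * f x * (\<Prod>z\<in>insert 0 S. sin ((x - z) / 2))" if "x \<in> {0..2*pi}" for x
    proof -
      \<comment> \<open>The factor belonging to the zero 0 is nonnegative on the whole period, so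
        adding it repairs the parity without disturbing the sign.\<close>
      have "0 \<le> sin (x / 2)" using that by (intro sin_ge_zero) auto
      then have "0 \<le> (e * f x * P x) * sin (x / 2)" by (rule mult_nonneg_nonneg[OF sgnP[OF that]])
      then show ?thesis using finS \<open>0 \<notin> S\<close> by (simp add: P_def mult_ac)
    qed
    ultimately show ?thesis using that by blast
  qed
  have finT: "finite T" using T fin finite_subset by blast
  have cardT: "card T < 2 * n" using card_mono[OF fin T(1)] card by simp
  define g where "g = (\<lambda>x. e * f x * (\<Prod>z\<in>T. sin ((x - z) / 2)))"
  have contg: "continuous_on {0..2*pi} g"
    unfolding g_def by (intro continuous_intros cont) auto
  \<comment> \<open>Zero frequency and phase make the cosine 1. The even cardinality of
    \<open>T\<close> gives integrality, and \<open>cardT\<close> gives the bound.\<close>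
  have "integral {0..2*pi} (\<lambda>x. f x * (\<Prod>z\<in>T. sin ((x - z) / 2)) * cos (0 * x + 0)) = 0"
    using T(2) cardT by (intro integral_sin_prod_eq_0[OF cont assms(3) finT]) (auto elim!: evenE)
  then have "integral {0..2*pi} g = 0"
    unfolding g_def by (simp add: mult.assoc)
  then have "(g has_integral 0) (cbox 0 (2 * pi))"
    using integrable_integral[OF integrable_continuous_interval[OF contg]] by simp
  then have "g x = 0" if "x \<in> {0..2*pi}" for x
    using has_integral_0_cbox_imp_0[of 0 "2 * pi" g x] contg sgnT that pi_gt_zero
    by (auto simp: g_def not_le)
  moreover have "g x \<noteq> 0" if x: "x \<in> {0<..<2*pi} - Z" for x
  proof -
    \<comment> \<open>Distinct points of one period differ by less than 2 pi, so the half-difference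
      is no multiple of pi.\<close>
    have "sin ((x - z) / 2) \<noteq> 0" if "z \<in> T" for z
    proof -
      have z: "0 \<le> z" "z < 2 * pi" "z \<noteq> x" "0 < x" "x < 2 * pi"
        using that T x by (auto simp: Z_def)
      show ?thesis
      proof (cases "z < x")
        case True
        then have "0 < (x - z) / 2" "(x - z) / 2 < pi" using z by (auto simp: field_simps)
        from sin_gt_zero[OF this] show ?thesis by linarith
      next
        case False
        then have "0 < - ((x - z) / 2)" "- ((x - z) / 2) < pi" using z by (auto simp: field_simps)
        from sin_gt_zero[OF this] show ?thesis unfolding sin_minus by linarith
      qed
    qed
    then show ?thesis using x e finT by (auto simp: g_def Z_def)
  qed
  ultimately have "{0<..<2*pi} \<subseteq> Z" by force
  then have "finite {0<..<2*pi}" using fin finite_subset by blast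
  then show False using infinite_Ioo[of 0 "2 * pi"] pi_gt_zero by simp
qed

end
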